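(* For every $h\in\mathbb{N}$, the morphism $\varphi_h$ is overlap-free. Consequently $\varphi$ is an overlap-free morphism.
   Context: $\mathbb{N}=\{0,1,2,\ldots\}$ is an alphabet; $x\cdot y$ denotes concatenation. An overlap is a word $cxcxc$ with $c$ a letter and $x$ a possibly empty word; a word is overlap-free if it has no overlap as a factor; a morphism is overlap-free if it maps every overlap-free word (in its domain) to an overlap-free word. $S$ is the left cyclic shift $S(cx)=xc$ and $S^{-1}$ its inverse, $S^{-1}(xc)=cx$. For each $h\in\mathbb{N}$ the morphism $\varphi_h \colon \{0,\ldots,h\}^* \to \{0,\ldots,h+1\}^*$ is defined recursively by $\varphi_h(h') = \varphi_{h'}(h')$ for $h'<h$ and $\varphi_h(h) = \big(S^{-1}(\varphi_{h-1}\circ\cdots\circ\varphi_0(00))\big)\cdot(h+1)$ (so $\varphi_0(0)=001$); $\varphi\colon\mathbb{N}^*\to\mathbb{N}^*$ is the common extension of all $\varphi_h$, i.e. $\varphi(h)=S^{-1}(\varphi^h(00))\cdot(h+1)$. *)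

theory Defs
  imports Main "HOL-Library.Sublist"
begin

definition overlap :: "'a list \<Rightarrow> bool" where
  "overlap w \<longleftrightarrow> (\<exists>c x. w = [c] @ x @ [c] @ x @ [c])"

definition overlap_free :: "'a list \<Rightarrow> bool" where
  "overlap_free w \<longleftrightarrow> (\<forall>u. sublist u w \<longrightarrow> \<not> overlap u)"

definition word_morphism :: "'a set \<Rightarrow> 'b set \<Rightarrow> ('a list \<Rightarrow> 'b list) \<Rightarrow> bool" where
  "word_morphism A B f \<longleftrightarrow>
     (\<forall>w\<in>lists A. f w \<in> lists B) \<and>
     (\<forall>u\<in>lists A. \<forall>v\<in>lists A. f (u @ v) = f u @ f v)"

definition overlap_free_morphism :: "'a set \<Rightarrow> 'b set \<Rightarrow> ('a list \<Rightarrow> 'b list) \<Rightarrow> bool" where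
  "overlap_free_morphism A B f \<longleftrightarrow>
     word_morphism A B f \<and> (\<forall>w\<in>lists A. overlap_free w \<longrightarrow> overlap_free (f w))"

definition extend :: "('a \<Rightarrow> 'b list) \<Rightarrow> 'a list \<Rightarrow> 'b list" where
  "extend f w = concat (map f w)"

lemma extend_cong [fundef_cong]:
  "v = w \<Longrightarrow> (\<And>c. c \<in> set w \<Longrightarrow> f c = g c) \<Longrightarrow> extend f v = extend g w"
  by (auto simp: extend_def intro!: arg_cong[where f = concat])

lemma extend_simps [simp]:
  "extend f [] = []" "extend f (c # w) = f c @ extend f w"
  "extend f (u @ v) = extend f u @ extend f v"
  by (simp_all add: extend_def)

text \<open>The left cyclic shift is \<^const>\<open>rotate1\<close>; this is its inverse.\<close>

definition unrotate1 :: "'a list \<Rightarrow> 'a list" where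
  "unrotate1 w = (if w = [] then [] else last w # butlast w)"

lemma unrotate1_snoc [simp]: "unrotate1 (x @ [c]) = c # x"
  by (simp add: unrotate1_def)

lemma rotate1_unrotate1: "rotate1 (unrotate1 w) = w"
  by (simp add: unrotate1_def)

lemma unrotate1_rotate1: "unrotate1 (rotate1 w) = w"
  by (cases w) (simp_all add: unrotate1_def)

lemma set_unrotate1 [simp]: "set (unrotate1 w) = set w"
  by (metis rotate1_unrotate1 set_rotate1)

text \<open>
  \<open>phi_letter h k\<close> is the image of the letter \<open>k\<close> under the morphism with index \<open>h\<close>; the value
  for \<open>k > h\<close>, outside the alphabet of that morphism, is arbitrary. The fold computes
  the image of the word 00 under the composition of the morphisms with indices
  \<open>h - 1, \<dots>, 0\<close>, the one with index 0 being applied first.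
\<close>

function phi_letter :: "nat \<Rightarrow> nat \<Rightarrow> nat list" where
  "phi_letter h k =
     (if k < h then phi_letter k k
      else if k = h then
        unrotate1 (fold (\<lambda>i w. extend (phi_letter i) w) [0..<h] [0, 0]) @ [h + 1]
      else [])"
  by pat_completeness auto
termination
  by (relation "Wellfounded.measure fst") auto

declare phi_letter.simps [simp del]

definition phi_at :: "nat \<Rightarrow> nat list \<Rightarrow> nat list" where
  "phi_at h = extend (phi_letter h)"

definition phi :: "nat list \<Rightarrow> nat list" where
  "phi = extend (\<lambda>h. phi_letter h h)"

lemma phi_letter_less: "k < h \<Longrightarrow> phi_letter h k = phi_letter k k"
  by (subst phi_letter.simps) simp

lemma phi_letter_self:
  "phi_letter h h = unrotate1 (fold phi_at [0..<h] [0, 0]) @ [h + 1]"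
  by (subst phi_letter.simps) (simp add: phi_at_def[abs_def])

lemma phi_extends_phi_at:
  assumes "w \<in> lists {0..h}"
  shows "phi w = phi_at h w"
  unfolding phi_def phi_at_def
proof (rule extend_cong[OF refl])
  fix c assume "c \<in> set w"
  with assms have "c \<le> h" by auto
  then show "phi_letter c c = phi_letter h c"
    by (cases "c = h") (simp_all add: phi_letter_less)
qed

lemma fold_phi_at:
  assumes "\<And>i. i < h \<Longrightarrow> set (phi_letter i i) \<subseteq> {0..i + 1}" and "n \<le> h"
  shows "fold phi_at [0..<n] [0, 0] = (phi ^^ n) [0, 0] \<and>
         set (fold phi_at [0..<n] [0, 0]) \<subseteq> {0..n}"
  using assms(2)
proof (induction n)
  case 0
  then show ?case by simp
next
  case (Suc n)
  define w where "w = fold phi_at [0..<n] [0, 0]"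
  from Suc have w: "w = (phi ^^ n) [0, 0]" "set w \<subseteq> {0..n}"
    unfolding w_def by (meson Suc_leD)+
  then have eq: "phi_at n w = phi w"
    by (intro phi_extends_phi_at[symmetric]) auto
  have "set (phi_letter c c) \<subseteq> {0..Suc n}" if "c \<in> set w" for c
    using assms(1)[of c] that w(2) Suc.prems by fastforce
  then have "set (phi w) \<subseteq> {0..Suc n}"
    by (auto simp: phi_def extend_def)
  with eq w show ?case by (simp add: w_def)
qed

lemma set_phi_letter_self: "set (phi_letter h h) \<subseteq> {0..h + 1}"
proof (induction h rule: less_induct)
  case (less h)
  have "set (fold phi_at [0..<h] [0, 0]) \<subseteq> {0..h}"
    using fold_phi_at[OF less order.refl] by blast
  then show ?case by (auto simp: phi_letter_self)
qed

lemma phi_letter_eq: "phi [h] = unrotate1 ((phi ^^ h) [0, 0]) @ [h + 1]"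
  using fold_phi_at[OF set_phi_letter_self order.refl, of h]
  by (simp add: phi_def[THEN fun_cong, of "[h]"] phi_letter_self)

lemma phi_at_0: "phi_at 0 [0] = [0, 0, 1]"
  by (simp add: phi_at_def phi_letter_self unrotate1_def)

lemma word_morphism_phi: "word_morphism UNIV UNIV phi"
  by (simp add: word_morphism_def phi_def)

lemma word_morphism_phi_at: "word_morphism {0..h} {0..h + 1} (phi_at h)"
proof -
  have "phi_at h w \<in> lists {0..h + 1}" if "w \<in> lists {0..h}" for w
  proof -
    have "set (phi w) \<subseteq> {0..h + 1}"
      using that set_phi_letter_self by (fastforce simp: phi_def extend_def)
    then show ?thesis
      using phi_extends_phi_at[OF that] by auto
  qed
  then show ?thesis by (simp add: word_morphism_def) (simp add: phi_at_def)
qed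

end

theory Submission
  imports Defs
begin

text \<open>
  Write \<open>\<phi>\<^sup>h(0) = u\<^sub>h h\<close>, where all letters of \<open>u\<^sub>h\<close> are smaller than \<open>h\<close>. Then
  \<open>\<phi>(h) = h u\<^sub>h h u\<^sub>h (h+1)\<close>, so a block \<open>\<phi>(h)\<close> is determined by its first letter and also by
  its last one. Hence an overlap in \<open>\<phi>(w)\<close> whose period shifts one block boundary onto another one
  lifts to an overlap in \<open>w\<close>. Let \<open>h\<close> be the largest letter of \<open>w\<close>. Every \<open>h+1\<close> in \<open>\<phi>(w)\<close> ends a
  block, so an overlap containing \<open>h+1\<close> lifts. An overlap without \<open>h+1\<close> lies in
  \<open>\<phi>(x) h u\<^sub>h h u\<^sub>h\<close>, where \<open>x\<close> is a factor of \<open>w\<close> without \<open>h\<close>. By induction it is a factor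
  neither of \<open>\<phi>(x)\<close> nor of \<open>u\<^sub>h h u\<^sub>h h = \<phi>\<^sup>h(00)\<close>, so it contains the \<open>h\<close> between these two.
  Comparing the letters in front of this \<open>h\<close> and of its translate by the period gives a
  contradiction: blocks end with a nonzero letter, but the last letter of every block, and \<open>h\<close>
  after \<open>u\<^sub>h\<close>, are preceded by 0.
\<close>

section \<open>Overlaps as a position and a period\<close>

text \<open>Positions are easy to carry between a word and its factors. The bound
  \<open>i + p\<close> is inclusive: these \<open>p + 1\<close> equations make the factor of length
  \<open>2 * p + 1\<close> at \<open>i\<close> an overlap.\<close>

definition overlap_at :: "'a list \<Rightarrow> nat \<Rightarrow> nat \<Rightarrow> bool" where
  "overlap_at w i p \<longleftrightarrow>
     0 < p \<and> i + 2 * p < length w \<and> (\<forall>k. i \<le> k \<longrightarrow> k \<le> i + p \<longrightarrow> w ! k = w ! (k + p))"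

lemma overlap_atD:
  assumes "overlap_at w i p"
  shows "0 < p" "i + 2 * p < length w"
    and "\<And>k. i \<le> k \<Longrightarrow> k \<le> i + p \<Longrightarrow> w ! (k + p) = w ! k"
  using assms by (auto simp: overlap_at_def)

lemma overlap_at_append:
  "overlap_at (xs @ w @ ys) (length xs + i) p" if "overlap_at w i p"
  unfolding overlap_at_def
proof (intro conjI allI impI)
  fix k assume "length xs + i \<le> k" "k \<le> length xs + i + p"
  moreover from this obtain j where "k = length xs + j"
    using le_Suc_ex by (metis add_leD1)
  ultimately show "(xs @ w @ ys) ! k = (xs @ w @ ys) ! (k + p)"
    using overlap_atD[OF that] by (simp add: nth_append)
qed (use overlap_atD[OF that] in auto)

lemma overlap_imp_overlap_at:
  assumes "overlap u" shows "\<exists>p. overlap_at u 0 p"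
proof -
  from assms obtain c x where "u = (c # x) @ (c # x) @ [c]"
    by (auto simp: overlap_def)
  then obtain y where u: "u = y @ y @ [hd y]" "y \<noteq> []"
    by (metis list.distinct(1) list.sel(1))
  have "overlap_at u 0 (length y)"
    unfolding overlap_at_def u(1)
  proof (intro conjI allI impI)
    fix k assume "k \<le> 0 + length y"
    then show "(y @ y @ [hd y]) ! k = (y @ y @ [hd y]) ! (k + length y)"
      using u(2) by (cases "k < length y") (auto simp: nth_append hd_conv_nth)
  qed (use u(2) in auto)
  then show ?thesis ..
qed

lemma overlap_at_imp_not_overlap_free:
  assumes "overlap_at w i p" shows "\<not> overlap_free w"
proof -
  note o = overlap_atD[OF assms]
  define c where "c = w ! i"
  define x where "x = take (p - 1) (drop (Suc i) w)"
  define u where "u = take (2 * p + 1) (drop i w)"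
  have len: "length x = p - 1" "length u = 2 * p + 1"
    using o by (auto simp: x_def u_def)
  have "u = [c] @ x @ [c] @ x @ [c]"
  proof (rule nth_equalityI)
    show "length u = length ([c] @ x @ [c] @ x @ [c])"
      using len o(1) by simp
    fix k assume "k < length u"
    then have k: "k \<le> 2 * p" using len by simp
    have u: "u ! k = w ! (i + k)"
      using k o by (simp add: u_def)
    have x: "x ! j = w ! (Suc i + j)" if "j < p - 1" for j
      using that o by (simp add: x_def)
    consider "k = 0" | "0 < k" "k < p" | "k = p" | "p < k" "k < 2 * p" | "k = 2 * p"
      using k by linarith
    then show "u ! k = ([c] @ x @ [c] @ x @ [c]) ! k"
    proof cases
      case 1 then show ?thesis using u by (simp add: c_def)
    next
      case 2 then show ?thesis
        using u x[of "k - 1"] len by (auto simp: nth_append nth_Cons')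
    next
      case 3 then show ?thesis
        using u o(3)[of i] len o(1) by (simp add: nth_append nth_Cons' c_def)
    next
      case 4
      then obtain m where m: "k = Suc (p + m)" using less_imp_Suc_add by blast
      then show ?thesis
        using 4 u o(3)[of "Suc (i + m)"] x[of m] len
        by (auto simp: nth_append nth_Cons' algebra_simps)
    next
      case 5 then show ?thesis
        using u o(3)[of i] o(3)[of "i + p"] len o(1)
        by (auto simp: nth_append nth_Cons' c_def add.assoc mult_2)
    qed
  qed
  then have "overlap u" unfolding overlap_def by blast
  moreover have "sublist u w"
    unfolding u_def by (meson sublist_drop sublist_order.order_trans sublist_take)
  ultimately show ?thesis by (auto simp: overlap_free_def)
qed

lemma overlap_free_iff: "overlap_free w \<longleftrightarrow> (\<forall>i p. \<not> overlap_at w i p)"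
proof
  assume "\<forall>i p. \<not> overlap_at w i p"
  then show "overlap_free w"
    unfolding overlap_free_def sublist_def
    by (metis overlap_imp_overlap_at overlap_at_append)
qed (use overlap_at_imp_not_overlap_free in blast)

lemma overlap_free_sublist: "overlap_free w \<Longrightarrow> sublist v w \<Longrightarrow> overlap_free v"
  unfolding overlap_free_def by (meson sublist_order.order_trans)

section \<open>Lifting overlaps through a morphism with recognizable blocks\<close>

text \<open>Decoding is greedy: a block is determined by its first letter. A block entered within
  the first \<open>n\<close> letters is thus known entirely, so the image of \<open>r\<close> covers
  all \<open>n\<close> of them.\<close>

lemma extend_common_prefix:
  assumes "\<And>a. f a \<noteq> []" "inj (\<lambda>a. hd (f a))"
    and "n \<le> length (extend f v)" "n \<le> length (extend f v')"
    and "take n (extend f v) = take n (extend f v')"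
  shows "\<exists>r. prefix r v \<and> prefix r v' \<and> n \<le> length (extend f r)"
  using assms(3-5)
proof (induction v arbitrary: v' n)
  case Nil
  then show ?case by auto
next
  case (Cons a v)
  show ?case
  proof (cases "n = 0")
    case False
    with Cons.prems obtain b w where v': "v' = b # w" by (cases v') auto
    have "hd (f a) = hd (f b)"
      using arg_cong[OF Cons.prems(3), of hd] False assms(1) by (simp add: v' hd_append)
    then have b: "b = a" using assms(2) by (auto dest: injD)
    show ?thesis
    proof (cases "n \<le> length (f a)")
      case True
      then show ?thesis by (intro exI[of _ "[a]"]) (simp add: v' b)
    next
      case False
      have "\<exists>r. prefix r v \<and> prefix r w \<and> n - length (f a) \<le> length (extend f r)"
        by (rule Cons.IH) (use Cons.prems False in \<open>auto simp: v' b\<close>)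
      then obtain r where "prefix r v" "prefix r w" "n - length (f a) \<le> length (extend f r)"
        by blast
      then show ?thesis by (intro exI[of _ "a # r"]) (auto simp: v' b)
    qed
  qed (auto intro: exI[of _ "[]"])
qed

lemma rev_extend: "rev (extend f w) = extend (\<lambda>a. rev (f a)) (rev w)"
  by (induction w) auto

text \<open>The mirror image of \<open>extend_common_prefix\<close>, by reversing words and
  blocks.\<close>

lemma extend_common_suffix:
  assumes "\<And>a. f a \<noteq> []" "inj (\<lambda>a. last (f a))"
    and "n \<le> length (extend f v)" "n \<le> length (extend f v')"
    and "drop (length (extend f v) - n) (extend f v) = drop (length (extend f v') - n) (extend f v')"
  shows "\<exists>r. suffix r v \<and> suffix r v' \<and> n \<le> length (extend f r)"
proof -
  have "take n (rev (extend f v)) = take n (rev (extend f v'))"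
    using assms(5) by (simp add: take_rev)
  then obtain r where r: "prefix r (rev v)" "prefix r (rev v')"
      "n \<le> length (extend (\<lambda>a. rev (f a)) r)"
    using extend_common_prefix[of "\<lambda>a. rev (f a)" n "rev v" "rev v'"] assms(1-4)
    by (auto simp: rev_extend[symmetric] hd_rev)
  have "length (extend (\<lambda>a. rev (f a)) r) = length (extend f (rev r))"
    using rev_extend[of f "rev r"] by (metis length_rev rev_rev_ident)
  with r show ?thesis
    by (intro exI[of _ "rev r"]) (auto simp: suffix_to_prefix)
qed

text \<open>The period of the overlap shifts the block boundary after \<open>w1\<close> onto the one after \<open>w1 @ z\<close>.\<close>

lemma synchronized_overlap:
  assumes f: "\<And>a. f a \<noteq> []" "inj (\<lambda>a. hd (f a))" "inj (\<lambda>a. last (f a))"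
    and ov: "overlap_at (extend f (w1 @ z @ w2)) i p"
    and bd: "i \<le> length (extend f w1)" "length (extend f w1) \<le> i + p + 1"
      "length (extend f z) = p"
  shows "\<not> overlap_free (w1 @ z @ w2)"
proof -
  let ?W = "extend f (w1 @ z @ w2)"
  note o = overlap_atD[OF ov]
  define j where "j = length (extend f w1)"
  define n where "n = i + p + 1 - j"
  have len: "length ?W = j + p + length (extend f w2)"
    using bd by (simp add: j_def)
  have nth_w1z: "(extend f w1 @ extend f z) ! k = ?W ! k" if "k < j + p" for k
    using that bd nth_append[of "extend f w1 @ extend f z" "extend f w2" k] by (simp add: j_def)
  \<comment> \<open>The \<open>n\<close> positions from the boundary \<open>j\<close> up to
    \<open>i + p\<close> are shifted by \<open>p\<close> to the start of
    \<open>extend f w2\<close>.\<close>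
  have "take n (extend f w2) = take n (extend f (z @ w2))"
  proof (rule nth_equalityI)
    fix k assume "k < length (take n (extend f w2))"
    then have k: "k < n" "k < length (extend f w2)" by auto
    have "?W ! (j + k + p) = ?W ! (j + k)"
      using o(3)[of "j + k"] k bd by (simp add: n_def j_def)
    moreover have "?W ! (j + k + p) = extend f w2 ! k"
      using bd by (simp add: nth_append j_def)
    moreover have "?W ! (j + k) = extend f (z @ w2) ! k"
      by (simp add: nth_append j_def)
    ultimately show "take n (extend f w2) ! k = take n (extend f (z @ w2)) ! k"
      using k by (simp del: extend_simps take_append)
  qed (use o(2) len bd in \<open>auto simp: n_def\<close>)
  then have "\<exists>r. prefix r w2 \<and> prefix r (z @ w2) \<and> n \<le> length (extend f r)"
    by (intro extend_common_prefix[OF f(1,2)]) (use o(2) len in \<open>auto simp: n_def\<close>)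
  then obtain r where r: "prefix r w2" "prefix r (z @ w2)" "n \<le> length (extend f r)"
    by blast
  \<comment> \<open>Likewise the \<open>j - i\<close> positions before the boundary are shifted to
    the end of \<open>extend f (w1 @ z)\<close>.\<close>
  have "drop i (extend f w1) = drop (i + p) (extend f (w1 @ z))"
  proof (rule nth_equalityI)
    fix k assume "k < length (drop i (extend f w1))"
    then have k: "i + k < j" by (auto simp: j_def)
    have "?W ! (i + k + p) = ?W ! (i + k)"
      using o(3)[of "i + k"] k bd by (simp add: j_def)
    moreover have "?W ! (i + k) = extend f w1 ! (i + k)"
      using k by (simp add: nth_append j_def)
    ultimately show "drop i (extend f w1) ! k = drop (i + p) (extend f (w1 @ z)) ! k"
      using k bd nth_w1z[of "i + k + p"]
      by (simp add: j_def algebra_simps del: drop_append)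
  qed (use bd in auto)
  moreover have "i = length (extend f w1) - (j - i)" "i + p = length (extend f (w1 @ z)) - (j - i)"
    using bd by (simp_all add: j_def)
  ultimately have "\<exists>s. suffix s w1 \<and> suffix s (w1 @ z) \<and> j - i \<le> length (extend f s)"
    by (intro extend_common_suffix[OF f(1,3)]) (simp_all add: j_def)
  then obtain s where s: "suffix s w1" "suffix s (w1 @ z)" "j - i \<le> length (extend f s)"
    by blast
  \<comment> \<open>The images of \<open>s\<close> and \<open>r\<close> have total length at least
    \<open>(j - i) + n = p + 1\<close>, so \<open>s\<close> and \<open>r\<close> cannot be disjoint
    factors of \<open>z\<close>, whose image has length \<open>p\<close>.\<close>
  have long: "length z < length s + length r"
  proof (rule ccontr)
    assume "\<not> length z < length s + length r"
    then have short: "length s + length r \<le> length z" by simp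
    with r(2) obtain z' where z': "z = r @ z'"
      by (metis add_leD2 prefix_length_prefix prefix_def prefixI)
    with s(2) short have "suffix s z'"
      by (metis add.commute add_le_cancel_left append.assoc length_append suffixI suffix_length_suffix)
    with z' obtain m where "z = r @ m @ s" by (auto simp: suffix_def)
    then have "length (extend f r) + length (extend f s) \<le> p"
      using bd(3) by auto
    with r(3) s(3) bd o(1) show False by (simp add: n_def j_def)
  qed
  obtain a where a: "w1 = a @ s" using s(1) by (auto simp: suffix_def)
  obtain a' where a': "w1 @ z = a' @ s" using s(2) by (auto simp: suffix_def)
  obtain b where b: "w2 = r @ b" using r(1) by (auto simp: prefix_def)
  obtain b' where b': "z @ w2 = r @ b'" using r(2) by (auto simp: prefix_def)
  \<comment> \<open>The lifted overlap begins with the copy of \<open>s\<close> that ends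
    \<open>w1\<close>. Its equations come from \<open>s\<close> left of the boundary and from
    \<open>r\<close> right of it.\<close>
  have "overlap_at (w1 @ z @ w2) (length a) (length z)"
    unfolding overlap_at_def
  proof (intro conjI allI impI)
    show "0 < length z" using bd(3) o(1) by auto
    show "length a + 2 * length z < length (w1 @ z @ w2)"
      using long by (simp add: a b)
    fix k assume k: "length a \<le> k" "k \<le> length a + length z"
    show "(w1 @ z @ w2) ! k = (w1 @ z @ w2) ! (k + length z)"
    proof (cases "k < length w1")
      case True
      have "length a' = length a + length z"
        using arg_cong[OF a', of length] by (simp add: a)
      moreover have "(w1 @ z @ w2) ! (k + length z) = (a' @ s) ! (k + length z)"
        using True nth_append[of "w1 @ z" w2 "k + length z"] unfolding a'[symmetric] by simp
      ultimately show ?thesis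
        using True k by (auto simp: nth_append a)
    next
      case False
      then obtain l where l: "k = length w1 + l" using le_Suc_ex by (metis not_le_imp_less nat_less_le)
      with k long have lr: "l < length r" by (simp add: a)
      have "(w1 @ z @ w2) ! k = (r @ b') ! l"
        unfolding b'[symmetric] l by (simp add: nth_append)
      moreover have "(w1 @ z @ w2) ! (k + length z) = w2 ! l"
        unfolding l by (simp add: nth_append)
      ultimately show ?thesis using lr by (simp add: b nth_append)
    qed
  qed
  then show ?thesis using overlap_free_iff by blast
qed

section \<open>The shape of the blocks\<close>

lemma phi_simps [simp]:
  "phi [] = []" "phi (a # w) = phi_letter a a @ phi w" "phi (u @ v) = phi u @ phi v"
  by (simp_all add: phi_def)

lemma phi_funpow_append: "(phi ^^ n) (u @ v) = (phi ^^ n) u @ (phi ^^ n) v"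
  by (induction n) auto

text \<open>This is the word \<open>u\<^sub>h\<close> of the overview.\<close>

definition core :: "nat \<Rightarrow> nat list" where
  "core h = butlast ((phi ^^ h) [0])"

text \<open>Conditional, because the induction for \<open>core_props\<close> needs it before the
  assumption is established in general.\<close>

lemma phi_letter_core_aux:
  assumes "(phi ^^ h) [0] = core h @ [h]"
  shows "phi_letter h h = h # core h @ h # core h @ [Suc h]"
proof -
  have "(phi ^^ h) [0, 0] = (core h @ h # core h) @ [h]"
    using phi_funpow_append[of h "[0]" "[0]"] assms by simp
  then show ?thesis
    using phi_letter_eq[of h] unrotate1_snoc[of "core h @ h # core h" h] by simp
qed

text \<open>All three claims are read off from the recursion
  \<open>core (Suc h) = phi (core h) @ h # core h @ h # core h\<close>, with
  \<open>core 0 = []\<close>.\<close>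

lemma core_props:
  "(phi ^^ h) [0] = core h @ [h] \<and> set (core h) \<subseteq> {..<h} \<and> (0 < h \<longrightarrow> (\<exists>v. core h = v @ [0]))"
proof (induction h)
  case 0
  then show ?case by (simp add: core_def)
next
  case (Suc h)
  have "(phi ^^ Suc h) [0] = (phi (core h) @ h # core h @ h # core h) @ [Suc h]"
    using Suc phi_letter_core_aux[of h] by simp
  then have core: "core (Suc h) = phi (core h) @ h # core h @ h # core h"
    and pow: "(phi ^^ Suc h) [0] = core (Suc h) @ [Suc h]"
    unfolding core_def by (metis butlast_snoc)+
  have "set (phi (core h)) \<subseteq> {..<Suc h}"
  proof
    fix c assume "c \<in> set (phi (core h))"
    then obtain a where "a \<in> set (core h)" "c \<in> set (phi_letter a a)"
      by (auto simp: phi_def extend_def)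
    with Suc set_phi_letter_self[of a] show "c \<in> {..<Suc h}" by fastforce
  qed
  with Suc have "set (core (Suc h)) \<subseteq> {..<Suc h}"
    unfolding core by (auto simp: less_Suc_eq)
  moreover have "\<exists>v. core (Suc h) = v @ [0]"
  proof (cases "h = 0")
    case True
    then show ?thesis unfolding core by (simp add: core_def)
  next
    case False
    with Suc show ?thesis unfolding core by fastforce
  qed
  ultimately show ?case using pow by blast
qed

lemmas phi_funpow_0 = core_props[THEN conjunct1]
lemmas set_core = core_props[THEN conjunct2, THEN conjunct1]
lemmas core_ends_with_0 = core_props[THEN conjunct2, THEN conjunct2, rule_format]
lemmas phi_letter_core = phi_letter_core_aux[OF phi_funpow_0]

text \<open>The 0 is the last letter of \<open>core h\<close>, except that for \<open>h = 0\<close>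
  it is the letter \<open>h\<close> itself.\<close>

lemma phi_letter_ends_with_0_Suc: "\<exists>v. phi_letter h h = v @ [0, Suc h]"
proof (cases "h = 0")
  case True
  then show ?thesis by (simp add: phi_letter_core core_def)
next
  case False
  then obtain v where "core h = v @ [0]" using core_ends_with_0 by auto
  then show ?thesis
    by (intro exI[of _ "h # core h @ h # v"]) (simp add: phi_letter_core)
qed

lemma last_phi: "w \<noteq> [] \<Longrightarrow> last (phi w) = Suc (last w)"
  by (cases w rule: rev_cases) (simp_all add: phi_letter_core)

section \<open>Occurrences of the largest letter in an image\<close>

text \<open>All letters of the block of \<open>a\<close> but the last are at most \<open>a\<close>,
  so \<open>Suc h\<close> can only end a block of \<open>h\<close> and marks a block
  boundary.\<close>

lemma phi_nth_Suc_max: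
  assumes "set w \<subseteq> {..h}" "k < length (phi w)" "phi w ! k = Suc h"
  shows "\<exists>v v'. w = (v @ [h]) @ v' \<and> length (phi (v @ [h])) = Suc k"
  using assms
proof (induction w arbitrary: k)
  case (Cons a w)
  show ?case
  proof (cases "k < length (phi_letter a a)")
    case True
    let ?B = "a # core a @ a # core a"
    have ex: "phi_letter a a = ?B @ [Suc a]" by (simp add: phi_letter_core)
    have nth: "phi_letter a a ! k = Suc h"
      using Cons.prems True by (simp add: nth_append)
    have "k = length ?B"
    proof (rule ccontr)
      assume "k \<noteq> length ?B"
      then have "k < length ?B" using True unfolding ex by simp
      then have "Suc h \<in> set ?B"
        using nth unfolding ex by (metis nth_append nth_mem)
      with set_core[of a] Cons.prems(1) show False by auto
    qed
    moreover from this have "a = h" using nth unfolding ex by (metis nth_append_length Suc_inject)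
    ultimately show ?thesis
      by (intro exI[of _ "[]"] exI[of _ w]) (simp add: phi_letter_core)
  next
    case False
    have "\<exists>v v'. w = (v @ [h]) @ v' \<and>
        length (phi (v @ [h])) = Suc (k - length (phi_letter a a))"
      by (rule Cons.IH) (use Cons.prems False in \<open>auto simp: nth_append\<close>)
    then obtain v v' where "w = (v @ [h]) @ v'"
      "length (phi (v @ [h])) = Suc (k - length (phi_letter a a))"
      by blast
    with False show ?thesis
      by (intro exI[of _ "a # v"] exI[of _ v']) simp
  qed
qed simp

lemma sublist_append_Cons_notin:
  assumes "sublist F (P @ c # Q)" "c \<notin> set F"
  shows "sublist F P \<or> sublist F Q"
proof -
  consider "sublist F P" | "sublist F (c # Q)"
    | F1 F2 where "F = F1 @ F2" "suffix F1 P" "prefix F2 (c # Q)"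
    using assms(1) unfolding sublist_append by blast
  then show ?thesis
  proof cases
    case 2
    then show ?thesis
      using assms(2) by (auto simp: sublist_Cons_right prefix_Cons)
  next
    case 3
    then show ?thesis
      using assms(2) by (auto simp: prefix_Cons suffix_imp_sublist)
  qed auto
qed

text \<open>Cut \<open>w\<close> at its first \<open>h\<close>, whose block ends with
  \<open>Suc h\<close>. As \<open>F\<close> avoids this letter, it lies before it, or after it and
  the induction continues with the rest of \<open>w\<close>.\<close>

lemma sublist_phi_without_Suc_max:
  assumes "set w \<subseteq> {..h}" "sublist F (phi w)" "Suc h \<notin> set F"
  shows "\<exists>x. sublist x w \<and> set x \<subseteq> {..<h} \<and> sublist F (phi x @ h # core h @ h # core h)"
  using assms
proof (induction w rule: length_induct)
  case (1 w)
  show ?case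
  proof (cases "h \<in> set w")
    case True
    then obtain x w' where w: "w = x @ h # w'" and x: "h \<notin> set x"
      using split_list_first[of h w] by blast
    have "sublist F ((phi x @ h # core h @ h # core h) @ Suc h # phi w')"
      using 1(3) by (simp add: w phi_letter_core)
    then consider "sublist F (phi x @ h # core h @ h # core h)" | "sublist F (phi w')"
      using sublist_append_Cons_notin[OF _ 1(4)] by blast
    then show ?thesis
    proof cases
      case 1
      have "set x \<subseteq> {..<h}" using \<open>set w \<subseteq> {..h}\<close> x
        by (auto simp: w order.strict_iff_order)
      with 1 show ?thesis unfolding w by blast
    next
      case 2
      have "\<exists>y. sublist y w' \<and> set y \<subseteq> {..<h} \<and>
          sublist F (phi y @ h # core h @ h # core h)"
        by (rule "1.IH"[rule_format]) (use 1(2,4) 2 w in auto)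
      then obtain y where "sublist y w'" "set y \<subseteq> {..<h}"
        "sublist F (phi y @ h # core h @ h # core h)"
        by blast
      moreover from this have "sublist y w" unfolding w
        by (simp add: sublist_append sublist_Cons_right)
      ultimately show ?thesis by blast
    qed
  next
    case False
    then have "set w \<subseteq> {..<h}" using 1(2) by (force simp: nat_less_le)
    with 1 show ?thesis
      by (intro exI[of _ w]) (auto simp: sublist_append)
  qed
qed

section \<open>Induction on the size of the alphabet\<close>

text \<open>The strict bound lets the induction start from the empty alphabet.\<close>

definition phi_free_below :: "nat \<Rightarrow> bool" where
  "phi_free_below h \<longleftrightarrow> (\<forall>w. set w \<subseteq> {..<h} \<longrightarrow> overlap_free w \<longrightarrow> overlap_free (phi w))"

text \<open>The case \<open>n = h\<close> is included because the last application of
  \<open>phi\<close> still acts on letters below \<open>h\<close>.\<close>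

lemma overlap_free_phi_funpow_00:
  assumes "phi_free_below h" "n \<le> h"
  shows "overlap_free ((phi ^^ n) [0, 0])"
  using assms(2)
proof (induction n)
  case 0
  have "overlap_free [0, 0 :: nat]"
    unfolding overlap_free_iff overlap_at_def by auto
  then show ?case by simp
next
  case (Suc n)
  have "(phi ^^ n) [0, 0] = core n @ n # core n @ [n]"
    using phi_funpow_append[of n "[0]" "[0]"] phi_funpow_0[of n] by simp
  then have "set ((phi ^^ n) [0, 0]) \<subseteq> {..<h}"
    using set_core[of n] Suc.prems by auto
  then show ?case using Suc assms(1) by (simp add: phi_free_below_def)
qed

text \<open>\<open>?V\<close> is \<open>phi (x @ [h])\<close> without its final
  \<open>Suc h\<close>; the induction hypothesis covers \<open>x\<close> but not
  \<open>x @ [h]\<close>.\<close>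

lemma overlap_free_phi_append_core:
  assumes free: "phi_free_below h" and x: "set x \<subseteq> {..<h}" "overlap_free x"
  shows "overlap_free (phi x @ h # core h @ h # core h)" (is "overlap_free ?V")
proof (rule ccontr)
  assume "\<not> overlap_free ?V"
  then obtain i p where "overlap_at ?V i p" by (auto simp: overlap_free_iff)
  note o = overlap_atD[OF this]
  define n where "n = length (phi x)"
  have V_n: "?V ! n = h" by (simp add: n_def)
  have V_less: "?V ! k = phi x ! k" if "k < n" for k
    using that by (simp add: n_def nth_append)
  have V_gt: "?V ! (n + Suc k) = (core h @ h # core h) ! k" for k
    by (simp add: n_def nth_append)
  have len: "length ?V = n + 2 * Suc (length (core h))" by (simp add: n_def)
  have V_last: "?V ! (n - 1) \<noteq> 0" if "0 < n"
  proof -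
    have "x \<noteq> []" using that by (auto simp: n_def)
    moreover from this have "phi x \<noteq> []" by (cases x) (auto simp: phi_letter_core)
    ultimately show ?thesis
      using that V_less[of "n - 1"] last_phi[of x] by (simp add: n_def last_conv_nth)
  qed
  have "overlap_free (phi x)" using free x by (simp add: phi_free_below_def)
  moreover have "overlap_at (phi x) i p" if "i + 2 * p < n"
    using o that V_less unfolding overlap_at_def by (simp add: n_def)
  ultimately have in_left: "n \<le> i + 2 * p" by (force simp: overlap_free_iff)
  have "overlap_free (core h @ h # core h @ [h])"
    using overlap_free_phi_funpow_00[OF free order.refl]
      phi_funpow_append[of h "[0]" "[0]"] phi_funpow_0[of h] by simp
  then have "overlap_free (core h @ h # core h)"
    by (rule overlap_free_sublist) (metis append.assoc append_Cons sublist_appendI append_Nil)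
  moreover have "overlap_at (core h @ h # core h) (i - Suc n) p" if "n < i"
    unfolding overlap_at_def
  proof (intro conjI allI impI)
    fix k assume "i - Suc n \<le> k" "k \<le> i - Suc n + p"
    then show "(core h @ h # core h) ! k = (core h @ h # core h) ! (k + p)"
      using o(3)[of "n + Suc k"] V_gt[of k] V_gt[of "k + p"] that by (simp add: add.assoc)
  qed (use o that len in auto)
  ultimately have in_right: "i \<le> n" by (force simp: overlap_free_iff)
  \<comment> \<open>The overlap contains position \<open>n\<close>. Its translate is
    \<open>n + p\<close> if \<open>n\<close> lies in the first \<open>p + 1\<close> positions, and
    \<open>n - p\<close> otherwise.\<close>
  show False
  proof (cases "n \<le> i + p")
    case True
    define k where "k = p - 1"
    have p: "p = Suc k" using o(1) by (simp add: k_def)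
    have nth_k: "(core h @ h # core h) ! k = h"
      using o(3)[OF in_right True] V_n V_gt[of k] by (simp add: p)
    have k: "k < length (core h @ h # core h)"
      using o(2) in_left True len by (auto simp: p)
    \<comment> \<open>To the right of \<open>n\<close>, the only \<open>h\<close> is the one between
      the two copies of \<open>core h\<close>; this fixes the period.\<close>
    have "k = length (core h)"
    proof (rule ccontr)
      assume "k \<noteq> length (core h)"
      then consider "k < length (core h)" | "length (core h) < k" by linarith
      then have "h \<in> set (core h)"
      proof cases
        case 1
        then show ?thesis using nth_k by (metis nth_append nth_mem)
      next
        case 2
        then have "core h ! (k - Suc (length (core h))) = h"
          using nth_k by (simp add: nth_append)
        moreover have "k - Suc (length (core h)) < length (core h)" using k 2 by auto
        ultimately show ?thesis by (metis nth_mem)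
      qed
      with set_core[of h] show False by auto
    qed
    \<comment> \<open>Now \<open>n + 2 * p\<close> is the length of \<open>?V\<close>, so an overlap
      starting at \<open>n\<close> would not fit, and \<open>n - 1\<close> belongs to the
      overlap.\<close>
    with o(2) len p have "i < n" by simp
    then have "x \<noteq> []" by (auto simp: n_def)
    with x(1) have "0 < h" by (cases x) auto
    then obtain v where v: "core h = v @ [0]" using core_ends_with_0 by blast
    have "?V ! (n - 1 + p) = ?V ! (n + Suc (length v))"
      using \<open>i < n\<close> p \<open>k = length (core h)\<close> by (simp add: v)
    also have "\<dots> = 0" unfolding V_gt by (simp add: v)
    finally show False using o(3)[of "n - 1"] V_last \<open>i < n\<close> True by simp
  next
    case False
    have "?V ! (n - p + p) = ?V ! (n - p)"
      by (rule o(3)) (use False in_left in auto)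
    moreover have "n - p + p = n" "n - p < n" using o(1) False by auto
    ultimately have "phi x ! (n - p) = h"
      using V_n V_less[of "n - p"] by metis
    moreover have "0 < h"
      using x(1) False by (cases x) (auto simp: n_def)
    then obtain g where g: "h = Suc g" by (cases h) auto
    \<comment> \<open>The letters of \<open>x\<close> are at most \<open>g\<close>, so the
      \<open>h = Suc g\<close> at \<open>n - p\<close> ends a block and is preceded by 0, whereas
      the letter at \<open>n - 1\<close> is nonzero.\<close>
    ultimately have "\<exists>y y'. x = (y @ [g]) @ y' \<and> length (phi (y @ [g])) = Suc (n - p)"
      using x(1) \<open>n - p < n\<close>
      by (intro phi_nth_Suc_max) (simp_all add: n_def lessThan_Suc_atMost)
    then obtain y y' where y: "x = (y @ [g]) @ y'" "length (phi (y @ [g])) = Suc (n - p)"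
      by blast
    obtain v where "phi_letter g g = v @ [0, Suc g]" using phi_letter_ends_with_0_Suc by blast
    then have "phi x = (phi y @ v) @ 0 # Suc g # phi y'" "length (phi y @ v) = n - p - 1"
      using y by simp_all
    then have "phi x ! (n - p - 1) = 0" by (metis nth_append_length)
    moreover have "?V ! (n - p - 1 + p) = ?V ! (n - p - 1)"
      using o(3)[of "n - p - 1"] False in_left by simp
    ultimately show False
      using V_last V_less[of "n - p - 1"] False o(1) by simp
  qed
qed

lemma phi_letter_nonempty: "phi_letter h h \<noteq> []"
  by (simp add: phi_letter_core)

lemma inj_hd_phi_letter: "inj (\<lambda>a. hd (phi_letter a a))"
  by (simp add: inj_def phi_letter_core)

lemma inj_last_phi_letter: "inj (\<lambda>a. last (phi_letter a a))"
  by (simp add: inj_def phi_letter_core)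

lemma phi_free_below_Suc:
  assumes "phi_free_below h" shows "phi_free_below (Suc h)"
  unfolding phi_free_below_def
proof (intro allI impI)
  fix w assume "set w \<subseteq> {..<Suc h}" and free: "overlap_free w"
  then have w: "set w \<subseteq> {..h}" by auto
  show "overlap_free (phi w)"
  proof (rule ccontr)
    assume "\<not> overlap_free (phi w)"
    then obtain i p where ov: "overlap_at (phi w) i p" by (auto simp: overlap_free_iff)
    note o = overlap_atD[OF ov]
    show False
    \<comment> \<open>By periodicity every letter of the overlap occurs among its first
      \<open>p + 1\<close> positions, where the translate by \<open>p\<close> is still inside the
      overlap.\<close>
    proof (cases "\<exists>k. i \<le> k \<and> k \<le> i + p \<and> phi w ! k = Suc h")
      case True
      then obtain k where k: "i \<le> k" "k \<le> i + p" "phi w ! k = Suc h" by blast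
      have "k < length (phi w)" "k + p < length (phi w)" "phi w ! (k + p) = Suc h"
        using k o(2) o(3)[OF k(1,2)] by auto
      \<comment> \<open>Both \<open>k\<close> and \<open>k + p\<close> end blocks, so the period
        maps a boundary to a boundary.\<close>
      note ex = phi_nth_Suc_max[OF w this(1) k(3)] phi_nth_Suc_max[OF w this(2,3)]
      obtain w1 y where w1: "w = w1 @ y" "length (phi w1) = Suc k"
        using ex(1) by blast
      obtain v y' where v: "w = v @ y'" "length (phi v) = Suc (k + p)"
        using ex(2) by blast
      have "\<not> prefix v w1" using w1(2) v(2) o(1) by (auto simp: prefix_def)
      then obtain z where z: "v = w1 @ z"
        using w1(1) v(1) by (metis prefixI prefix_def prefix_same_cases)
      have "\<not> overlap_free (w1 @ z @ y')"
      proof (rule synchronized_overlap[of "\<lambda>a. phi_letter a a" w1 z y' i p])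
        show "overlap_at (extend (\<lambda>a. phi_letter a a) (w1 @ z @ y')) i p"
          using ov unfolding v(1) z by (simp add: phi_def)
      qed (use k w1(2) v(2) z in
          \<open>auto simp: phi_letter_nonempty inj_hd_phi_letter inj_last_phi_letter phi_def\<close>)
      with free show False by (simp add: v(1) z)
    next
      case False
      define F where "F = take (2 * p + 1) (drop i (phi w))"
      have lenF: "length F = 2 * p + 1" using o by (simp add: F_def)
      have nthF: "F ! k = phi w ! (i + k)" if "k \<le> 2 * p" for k
        using that o by (simp add: F_def)
      have "Suc h \<notin> set F"
      proof
        assume "Suc h \<in> set F"
        then obtain k where "k \<le> 2 * p" "phi w ! (i + k) = Suc h"
          using lenF nthF by (auto simp: in_set_conv_nth less_Suc_eq_le)
        then show False
          using False o(3)[of "i + (k - p)"]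
          by (cases "k \<le> p") (force, metis add.assoc add_le_cancel_left le_add1 le_add_diff_inverse2
              le_diff_conv mult_2 nat_le_linear)
      qed
      moreover have "sublist F (phi w)"
        unfolding F_def by (meson sublist_drop sublist_order.order_trans sublist_take)
      ultimately obtain x where x: "sublist x w" "set x \<subseteq> {..<h}"
        "sublist F (phi x @ h # core h @ h # core h)"
        using sublist_phi_without_Suc_max[OF w] by blast
      have "overlap_free F"
        using overlap_free_sublist overlap_free_phi_append_core[OF assms x(2)] free x by blast
      moreover have "overlap_at F 0 p"
        unfolding overlap_at_def
      proof (intro conjI allI impI)
        fix k assume "k \<le> 0 + p"
        then show "F ! k = F ! (k + p)"
          using nthF[of k] nthF[of "k + p"] o(3)[of "i + k"] by (simp add: add.assoc)
      qed (use o lenF in auto)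
      ultimately show False by (simp add: overlap_free_iff)
    qed
  qed
qed

lemma phi_free_below: "phi_free_below h"
proof (induction h)
  case 0
  show ?case by (simp add: phi_free_below_def)
qed (rule phi_free_below_Suc)

lemma overlap_free_phi:
  assumes "overlap_free w" shows "overlap_free (phi w)"
proof -
  \<comment> \<open>For \<open>w = []\<close> the maximum is unspecified, but the inclusion is
    trivial.\<close>
  have "set w \<subseteq> {..<Suc (Max (set w))}" by (auto simp: less_Suc_eq_le)
  then show ?thesis using phi_free_below assms unfolding phi_free_below_def by blast
qed

theorem theorem6:
  "(\<forall>h::nat. overlap_free_morphism {0..h} {0..h + 1} (phi_at h)) \<and>
   overlap_free_morphism UNIV UNIV phi"
  unfolding overlap_free_morphism_def
  using word_morphism_phi_at word_morphism_phi overlap_free_phi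
  \<comment> \<open>Each \<open>phi_at h\<close> agrees with \<open>phi\<close> on its domain, so
    \<open>overlap_free_phi\<close> settles both claims.\<close>
  by (simp flip: phi_extends_phi_at)

end
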